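(* Let $\mathsf{CS}$ be an arbitrary constant specification for $\mathsf{JE}$. For every formula $F$: $\mathsf{JE}_{\mathsf{CS}} \vdash F$ if and only if $\varepsilon \Vdash F$ for every basic model $\varepsilon$ for $\mathsf{JE}_{\mathsf{CS}}$.
   Context: Language. Fix countably many proof constants $\alpha_1,\alpha_2,\dots$, proof variables $\xi_1,\xi_2,\dots$, and a countable set $\mathsf{Prop}$ of atomic propositions. Proof terms: $\lambda ::= \alpha_i \mid \xi_i \mid (\lambda\cdot\lambda) \mid (\lambda+\lambda) \mid\ !\lambda$; their set is $\mathsf{PTm}$. Justification terms: $t ::= \mathsf{e}(\lambda)$ with $\lambda\in\mathsf{PTm}$; their set is $\mathsf{JTm}$. Formulas: $F ::= P \mid \bot \mid (F\to F) \mid \lambda : F \mid [t]F$ with $P\in\mathsf{Prop}$, $\lambda\in\mathsf{PTm}$, $t\in\mathsf{JTm}$; the set of formulas is $\mathsf{Fm}$, and $\neg,\wedge,\vee,\leftrightarrow$ are the usual classical abbreviations. Axioms of $\mathsf{JE}$: all instances of classical propositional tautologies, and all instances of (j) $\lambda:(F\to G)\to(\kappa:F\to \lambda\cdot\kappa:G)$; (j+$_1$) $(\lambda:F\vee\kappa:F)\to(\lambda+\kappa):F$; (jt) $\lambda:F\to F$; (j4) $\lambda:F\to\ !\lambda:\lambda:F$; (je) $(\lambda:(F\to G)\wedge\lambda:(G\to F))\to([\mathsf{e}(\lambda)]F\to[\mathsf{e}(\lambda)]G)$; (je+) $([\mathsf{e}(\lambda)]F\vee[\mathsf{e}(\kappa)]F)\to[\mathsf{e}(\lambda+\kappa)]F$.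 A constant specification $\mathsf{CS}$ is any set of pairs $(\alpha,A)$ with $\alpha$ a proof constant and $A$ an axiom of $\mathsf{JE}$. The logic $\mathsf{JE}_{\mathsf{CS}}$ is the Hilbert system whose axioms are those of $\mathsf{JE}$ and whose rules are modus ponens and axiom necessitation: infer $\alpha:A$ whenever $(\alpha,A)\in\mathsf{CS}$. Semantics. For sets of formulas $X,Y$ and a proof term $\lambda$: $\lambda:X=\{\lambda:F\mid F\in X\}$; $X\cdot Y=\{F\mid G\to F\in X \text{ for some } G\in Y\}$; $X\odot Y=\{F\mid F\to G\in X \text{ and } G\to F\in X \text{ for some } G\in Y\}$. A basic evaluation for $\mathsf{JE}_{\mathsf{CS}}$ is a function $\varepsilon$ with $\varepsilon(P)\in\{0,1\}$ for $P\in\mathsf{Prop}$ and $\varepsilon:\mathsf{PTm}\cup\mathsf{JTm}\to\mathcal P(\mathsf{Fm})$ such that for all $\lambda,\kappa\in\mathsf{PTm}$: (1) $\varepsilon(\lambda)\cdot\varepsilon(\kappa)\subseteq\varepsilon(\lambda\cdot\kappa)$; (2) $\varepsilon(\lambda)\cup\varepsilon(\kappa)\subseteq\varepsilon(\lambda+\kappa)$; (3) $F\in\varepsilon(\lambda)$ if $(\lambda,F)\in\mathsf{CS}$; (4) $\lambda:\varepsilon(\lambda)\subseteq\varepsilon(!\lambda)$; (5) $\varepsilon(\lambda)\odot\varepsilon(\mathsf{e}(\lambda))\subseteq\varepsilon(\mathsf{e}(\lambda))$; (6) $\varepsilon(\mathsf{e}(\lambda))\cup\varepsilon(\mathsf{e}(\kappa))\subseteq\varepsilon(\mathsf{e}(\lambda+\kappa))$.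 Truth: $\varepsilon\nVdash\bot$; $\varepsilon\Vdash P$ iff $\varepsilon(P)=1$; $\varepsilon\Vdash F\to G$ iff $\varepsilon\nVdash F$ or $\varepsilon\Vdash G$; $\varepsilon\Vdash\lambda:F$ iff $F\in\varepsilon(\lambda)$; $\varepsilon\Vdash[t]F$ iff $F\in\varepsilon(t)$. A basic model is a basic evaluation that is factive: $\varepsilon\Vdash\lambda:F$ implies $\varepsilon\Vdash F$ for all $\lambda,F$. *)

theory Defs
  imports "HOL-Library.Countable"
begin

section \<open>Language\<close>

datatype ptm =
    PConst nat
  | PVar nat
  | PApp ptm ptm  (infixl "\<^bold>\<cdot>" 75)
  | PPlus ptm ptm  (infixl "\<^bold>+" 70)
  | PBang ptm  ("\<^bold>! _" [80] 80)

datatype jtm = E ptm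

text \<open>The type parameter is the set of atomic propositions.\<close>

datatype 'p fm =
    Atom 'p
  | Bot  ("\<^bold>\<bottom>")
  | Imp "'p fm" "'p fm"  (infixr "\<^bold>\<rightarrow>" 45)
  | Prf ptm "'p fm"  (infixr "\<^bold>:" 60)
  | Just jtm "'p fm"  ("\<^bold>[_\<^bold>] _" [0, 60] 60)

abbreviation Neg :: "'p fm \<Rightarrow> 'p fm"  ("\<^bold>\<not> _" [60] 60)
  where "\<^bold>\<not> F \<equiv> F \<^bold>\<rightarrow> \<^bold>\<bottom>"

abbreviation Or :: "'p fm \<Rightarrow> 'p fm \<Rightarrow> 'p fm"  (infixr "\<^bold>\<or>" 50)
  where "F \<^bold>\<or> G \<equiv> \<^bold>\<not> F \<^bold>\<rightarrow> G"

abbreviation And :: "'p fm \<Rightarrow> 'p fm \<Rightarrow> 'p fm"  (infixr "\<^bold>\<and>" 55)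
  where "F \<^bold>\<and> G \<equiv> \<^bold>\<not> (F \<^bold>\<rightarrow> \<^bold>\<not> G)"


section \<open>Instances of propositional tautologies\<close>

text \<open>Tautologies are purely propositional schemes over the schematic letters
  \<open>SVar n\<close>; an instance replaces the letters by arbitrary formulas.\<close>

datatype scheme = SVar nat | SBot | SImp scheme scheme

primrec scheme_val :: "(nat \<Rightarrow> bool) \<Rightarrow> scheme \<Rightarrow> bool" where
  "scheme_val v (SVar n) \<longleftrightarrow> v n"
| "scheme_val v SBot \<longleftrightarrow> False"
| "scheme_val v (SImp A B) \<longleftrightarrow> (scheme_val v A \<longrightarrow> scheme_val v B)"

definition tautology :: "scheme \<Rightarrow> bool" where
  "tautology A \<longleftrightarrow> (\<forall>v. scheme_val v A)"

primrec scheme_inst :: "(nat \<Rightarrow> 'p fm) \<Rightarrow> scheme \<Rightarrow> 'p fm" where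
  "scheme_inst s (SVar n) = s n"
| "scheme_inst s SBot = \<^bold>\<bottom>"
| "scheme_inst s (SImp A B) = (scheme_inst s A \<^bold>\<rightarrow> scheme_inst s B)"


section \<open>The logic JE\<close>

inductive JE_axiom :: "'p fm \<Rightarrow> bool" where
  taut: "tautology A \<Longrightarrow> JE_axiom (scheme_inst s A)"
| j: "JE_axiom (l \<^bold>: (F \<^bold>\<rightarrow> G) \<^bold>\<rightarrow> (k \<^bold>: F \<^bold>\<rightarrow> (l \<^bold>\<cdot> k) \<^bold>: G))"
| jplus: "JE_axiom ((l \<^bold>: F \<^bold>\<or> k \<^bold>: F) \<^bold>\<rightarrow> (l \<^bold>+ k) \<^bold>: F)"
| jt: "JE_axiom (l \<^bold>: F \<^bold>\<rightarrow> F)"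
| j4: "JE_axiom (l \<^bold>: F \<^bold>\<rightarrow> (\<^bold>! l) \<^bold>: (l \<^bold>: F))"
| je: "JE_axiom ((l \<^bold>: (F \<^bold>\<rightarrow> G) \<^bold>\<and> l \<^bold>: (G \<^bold>\<rightarrow> F))
        \<^bold>\<rightarrow> (\<^bold>[E l\<^bold>] F \<^bold>\<rightarrow> \<^bold>[E l\<^bold>] G))"
| jeplus: "JE_axiom ((\<^bold>[E l\<^bold>] F \<^bold>\<or> \<^bold>[E k\<^bold>] F) \<^bold>\<rightarrow> \<^bold>[E (l \<^bold>+ k)\<^bold>] F)"

definition constant_specification :: "(ptm \<times> 'p fm) set \<Rightarrow> bool" where
  "constant_specification CS \<longleftrightarrow>
     (\<forall>(l, A) \<in> CS. (\<exists>i. l = PConst i) \<and> JE_axiom A)"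

inductive JE_derivable :: "(ptm \<times> 'p fm) set \<Rightarrow> 'p fm \<Rightarrow> bool"
    (infix "\<turnstile>" 40) for CS where
  ax: "JE_axiom F \<Longrightarrow> CS \<turnstile> F"
| mp: "CS \<turnstile> F \<^bold>\<rightarrow> G \<Longrightarrow> CS \<turnstile> F \<Longrightarrow> CS \<turnstile> G"
| an: "(l, A) \<in> CS \<Longrightarrow> CS \<turnstile> l \<^bold>: A"


section \<open>Basic models\<close>

definition prf_set :: "ptm \<Rightarrow> 'p fm set \<Rightarrow> 'p fm set" where
  "prf_set l X = {l \<^bold>: F | F. F \<in> X}"

definition app_set :: "'p fm set \<Rightarrow> 'p fm set \<Rightarrow> 'p fm set" where
  "app_set X Y = {F. \<exists>G\<in>Y. (G \<^bold>\<rightarrow> F) \<in> X}"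

definition odot_set :: "'p fm set \<Rightarrow> 'p fm set \<Rightarrow> 'p fm set"  (infixl "\<odot>" 75) where
  "X \<odot> Y = {F. \<exists>G\<in>Y. (F \<^bold>\<rightarrow> G) \<in> X \<and> (G \<^bold>\<rightarrow> F) \<in> X}"

text \<open>The single function on atoms, proof terms and justification terms is
  split into its three restrictions; the truth values 0 and 1 are \<open>bool\<close>.\<close>

record 'p evaluation =
  aval :: "'p \<Rightarrow> bool"
  pval :: "ptm \<Rightarrow> 'p fm set"
  jval :: "jtm \<Rightarrow> 'p fm set"

definition basic_evaluation :: "(ptm \<times> 'p fm) set \<Rightarrow> 'p evaluation \<Rightarrow> bool" where
  "basic_evaluation CS \<epsilon> \<longleftrightarrow>
     (\<forall>l k. app_set (pval \<epsilon> l) (pval \<epsilon> k) \<subseteq> pval \<epsilon> (l \<^bold>\<cdot> k)) \<and>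
     (\<forall>l k. pval \<epsilon> l \<union> pval \<epsilon> k \<subseteq> pval \<epsilon> (l \<^bold>+ k)) \<and>
     (\<forall>l F. (l, F) \<in> CS \<longrightarrow> F \<in> pval \<epsilon> l) \<and>
     (\<forall>l. prf_set l (pval \<epsilon> l) \<subseteq> pval \<epsilon> (\<^bold>! l)) \<and>
     (\<forall>l. pval \<epsilon> l \<odot> jval \<epsilon> (E l) \<subseteq> jval \<epsilon> (E l)) \<and>
     (\<forall>l k. jval \<epsilon> (E l) \<union> jval \<epsilon> (E k) \<subseteq> jval \<epsilon> (E (l \<^bold>+ k)))"

primrec truth :: "'p evaluation \<Rightarrow> 'p fm \<Rightarrow> bool"  (infix "\<tturnstile>" 40) where
  "\<epsilon> \<tturnstile> Atom P \<longleftrightarrow> aval \<epsilon> P"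
| "\<epsilon> \<tturnstile> \<^bold>\<bottom> \<longleftrightarrow> False"
| "\<epsilon> \<tturnstile> (F \<^bold>\<rightarrow> G) \<longleftrightarrow> (\<not> (\<epsilon> \<tturnstile> F) \<or> (\<epsilon> \<tturnstile> G))"
| "\<epsilon> \<tturnstile> (l \<^bold>: F) \<longleftrightarrow> F \<in> pval \<epsilon> l"
| "\<epsilon> \<tturnstile> (\<^bold>[t\<^bold>] F) \<longleftrightarrow> F \<in> jval \<epsilon> t"

definition factive :: "'p evaluation \<Rightarrow> bool" where
  "factive \<epsilon> \<longleftrightarrow> (\<forall>l F. (\<epsilon> \<tturnstile> l \<^bold>: F) \<longrightarrow> (\<epsilon> \<tturnstile> F))"

definition basic_model :: "(ptm \<times> 'p fm) set \<Rightarrow> 'p evaluation \<Rightarrow> bool" where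
  "basic_model CS \<epsilon> \<longleftrightarrow> basic_evaluation CS \<epsilon> \<and> factive \<epsilon>"

end

(* Completeness: if F is not derivable, Zorn's lemma gives a deductively closed set T of formulas
   that contains all theorems and is maximal among those omitting F. Maximality makes membership
   in T commute with implication and falsum, so reading the values of atoms, proof terms and
   justification terms off T yields a canonical evaluation whose true formulas are exactly the
   elements of T. The axioms in T then say that it is a basic model, and it refutes F. *)
theory Submission
  imports Defs
begin

text \<open>A letter of a scheme acts as a propositional variable valued by the truth of the formula
  put in its place. Hence tautology instances are true in every evaluation, basic or not.\<close>

lemma truth_scheme_inst: "(\<epsilon> \<tturnstile> scheme_inst s A) \<longleftrightarrow> scheme_val (\<lambda>n. \<epsilon> \<tturnstile> s n) A"
  by (induction A) auto

text \<open>Apart from tautologies, each axiom is matched by one semantic condition: jt by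
  factivity, each of the others by a closure condition of basic evaluations.\<close>

lemma JE_axiom_truth:
  assumes "JE_axiom F" "basic_model CS \<epsilon>"
  shows "\<epsilon> \<tturnstile> F"
  using assms
proof (induction rule: JE_axiom.induct)
  case (taut A s)
  then show ?case
    by (simp add: truth_scheme_inst tautology_def)
next
  case (j l F G k)
  then have "app_set (pval \<epsilon> l) (pval \<epsilon> k) \<subseteq> pval \<epsilon> (l \<^bold>\<cdot> k)"
    by (simp add: basic_model_def basic_evaluation_def)
  then show ?case
    by (auto simp: app_set_def)
next
  case (jplus l F k)
  then have "pval \<epsilon> l \<union> pval \<epsilon> k \<subseteq> pval \<epsilon> (l \<^bold>+ k)"
    by (simp add: basic_model_def basic_evaluation_def)
  then show ?case
    by auto
next
  case (jt l F)
  then show ?case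
    by (auto simp: basic_model_def factive_def)
next
  case (j4 l F)
  then have "prf_set l (pval \<epsilon> l) \<subseteq> pval \<epsilon> (\<^bold>! l)"
    by (simp add: basic_model_def basic_evaluation_def)
  then show ?case
    by (auto simp: prf_set_def)
next
  case (je l F G)
  then have "pval \<epsilon> l \<odot> jval \<epsilon> (E l) \<subseteq> jval \<epsilon> (E l)"
    by (simp add: basic_model_def basic_evaluation_def)
  then show ?case
    by (auto simp: odot_set_def)
next
  case (jeplus l F k)
  then have "jval \<epsilon> (E l) \<union> jval \<epsilon> (E k) \<subseteq> jval \<epsilon> (E (l \<^bold>+ k))"
    by (simp add: basic_model_def basic_evaluation_def)
  then show ?case
    by auto
qed

lemma soundness:
  assumes "CS \<turnstile> F" "basic_model CS \<epsilon>"
  shows "\<epsilon> \<tturnstile> F"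
  using assms
proof (induction rule: JE_derivable.induct)
  case (ax F)
  then show ?case
    by (rule JE_axiom_truth)
next
  case (mp F G)
  then show ?case
    by simp
next
  case (an l A)
  then show ?case
    by (simp add: basic_model_def basic_evaluation_def)
qed

text \<open>Axiom necessitation is covered by the first clause, since its conclusions are theorems.
  Consistency is not demanded: it will follow from the omission of a formula.\<close>

definition theory_over :: "(ptm \<times> 'p fm) set \<Rightarrow> 'p fm set \<Rightarrow> bool" where
  "theory_over CS T \<longleftrightarrow>
     (\<forall>F. CS \<turnstile> F \<longrightarrow> F \<in> T) \<and> (\<forall>F G. (F \<^bold>\<rightarrow> G) \<in> T \<longrightarrow> F \<in> T \<longrightarrow> G \<in> T)"

lemma theory_over_theorem: "theory_over CS T \<Longrightarrow> CS \<turnstile> F \<Longrightarrow> F \<in> T"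
  by (simp add: theory_over_def)

lemma theory_over_mp: "theory_over CS T \<Longrightarrow> (F \<^bold>\<rightarrow> G) \<in> T \<Longrightarrow> F \<in> T \<Longrightarrow> G \<in> T"
  by (auto simp: theory_over_def)

lemma theory_over_theorems: "theory_over CS {F. CS \<turnstile> F}"
  by (auto simp: theory_over_def intro: JE_derivable.mp)

text \<open>The two premises of a modus ponens may come from different members of the chain, but the
  larger of the two members contains both.\<close>

lemma theory_over_Union_chain:
  assumes "\<C> \<noteq> {}" "subset.chain (Collect (theory_over CS)) \<C>"
  shows "theory_over CS (\<Union>\<C>)"
  unfolding theory_over_def
proof (intro conjI allI impI)
  fix F assume "CS \<turnstile> F"
  with assms show "F \<in> \<Union>\<C>"
    by (fastforce simp: subset.chain_def theory_over_def)
next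
  fix F G assume "(F \<^bold>\<rightarrow> G) \<in> \<Union>\<C>" "F \<in> \<Union>\<C>"
  then obtain X Y where XY: "X \<in> \<C>" "(F \<^bold>\<rightarrow> G) \<in> X" "Y \<in> \<C>" "F \<in> Y"
    by auto
  then have "X \<subseteq> Y \<or> Y \<subseteq> X"
    using assms(2) by (auto simp: subset.chain_def)
  moreover have "theory_over CS X" "theory_over CS Y"
    using assms(2) XY by (auto simp: subset.chain_def)
  ultimately show "G \<in> \<Union>\<C>"
    using XY theory_over_mp by blast
qed

lemma derivable_K: "CS \<turnstile> A \<^bold>\<rightarrow> B \<^bold>\<rightarrow> A"
  using JE_derivable.ax[OF taut[of "SImp (SVar 0) (SImp (SVar 1) (SVar 0))"
      "\<lambda>n. if n = 0 then A else B"]]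
  by (simp add: tautology_def)

lemma derivable_I: "CS \<turnstile> A \<^bold>\<rightarrow> A"
  using JE_derivable.ax[OF taut[of "SImp (SVar 0) (SVar 0)" "\<lambda>n. A"]]
  by (simp add: tautology_def)

lemma derivable_S: "CS \<turnstile> (A \<^bold>\<rightarrow> B \<^bold>\<rightarrow> C) \<^bold>\<rightarrow> (A \<^bold>\<rightarrow> B) \<^bold>\<rightarrow> A \<^bold>\<rightarrow> C"
  using JE_derivable.ax[OF taut[of "SImp (SImp (SVar 0) (SImp (SVar 1) (SVar 2)))
        (SImp (SImp (SVar 0) (SVar 1)) (SImp (SVar 0) (SVar 2)))"
      "\<lambda>n. if n = 0 then A else if n = 1 then B else C"]]
  by (simp add: tautology_def)

lemma derivable_Bot_imp: "CS \<turnstile> \<^bold>\<bottom> \<^bold>\<rightarrow> A"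
  using JE_derivable.ax[OF taut[of "SImp SBot (SVar 0)" "\<lambda>n. A"]]
  by (simp add: tautology_def)

text \<open>If A is false then A -> B holds, so F follows from one of the two premises. Taking A for
  F gives Peirce's law: this is where classical logic enters the maximality argument.\<close>

lemma derivable_imp_cases: "CS \<turnstile> (A \<^bold>\<rightarrow> F) \<^bold>\<rightarrow> ((A \<^bold>\<rightarrow> B) \<^bold>\<rightarrow> F) \<^bold>\<rightarrow> F"
proof -
  let ?A = "SImp (SImp (SVar 0) (SVar 2)) (SImp (SImp (SImp (SVar 0) (SVar 1)) (SVar 2)) (SVar 2))"
  have "tautology ?A"
    by (auto simp: tautology_def)
  then have "CS \<turnstile> scheme_inst (\<lambda>n. if n = 0 then A else if n = 1 then B else F) ?A"
    by (intro JE_derivable.ax taut)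
  then show ?thesis
    by simp
qed

text \<open>Closure of this set under modus ponens is the deduction theorem.\<close>

lemma theory_over_extension:
  assumes "theory_over CS T"
  shows "theory_over CS {G. (A \<^bold>\<rightarrow> G) \<in> T}"
  unfolding theory_over_def mem_Collect_eq
proof (intro conjI allI impI)
  fix F assume "CS \<turnstile> F"
  then show "(A \<^bold>\<rightarrow> F) \<in> T"
    using assms derivable_K theory_over_mp theory_over_theorem by blast
next
  fix F G assume "(A \<^bold>\<rightarrow> F \<^bold>\<rightarrow> G) \<in> T" "(A \<^bold>\<rightarrow> F) \<in> T"
  then show "(A \<^bold>\<rightarrow> G) \<in> T"
    using assms derivable_S theory_over_mp theory_over_theorem by blast
qed

text \<open>These are the truth clauses for falsum and implication with membership in place of
  truth. Taking falsum for B shows that exactly one of A and its negation lies in T.\<close>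

definition saturated :: "'p fm set \<Rightarrow> bool" where
  "saturated T \<longleftrightarrow> \<^bold>\<bottom> \<notin> T \<and> (\<forall>A B. (A \<^bold>\<rightarrow> B) \<in> T \<longleftrightarrow> A \<notin> T \<or> B \<in> T)"

lemma saturated_if_maximal:
  assumes T: "theory_over CS T" "F \<notin> T"
    and maximal: "\<And>X. theory_over CS X \<Longrightarrow> F \<notin> X \<Longrightarrow> T \<subseteq> X \<Longrightarrow> X = T"
  shows "saturated T"
proof -
  \<comment> \<open>Otherwise the formulas G with A -> G in T form a theory that includes T and
    omits F. By maximality it equals T, yet it contains A.\<close>
  have imp_F: "(A \<^bold>\<rightarrow> F) \<in> T" if "A \<notin> T" for A
  proof (rule ccontr)
    assume "(A \<^bold>\<rightarrow> F) \<notin> T"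
    moreover have "T \<subseteq> {G. (A \<^bold>\<rightarrow> G) \<in> T}"
      using T(1) derivable_K theory_over_mp theory_over_theorem by blast
    ultimately have "{G. (A \<^bold>\<rightarrow> G) \<in> T} = T"
      using maximal theory_over_extension[OF T(1)] by simp
    then show False
      using that derivable_I theory_over_theorem[OF T(1)] by blast
  qed
  have "\<^bold>\<bottom> \<notin> T"
    using T derivable_Bot_imp theory_over_mp theory_over_theorem by blast
  moreover have "(A \<^bold>\<rightarrow> B) \<in> T \<longleftrightarrow> A \<notin> T \<or> B \<in> T" for A B
  proof
    show "A \<notin> T \<or> B \<in> T" if "(A \<^bold>\<rightarrow> B) \<in> T"
      using that T(1) theory_over_mp by blast
  next
    assume "A \<notin> T \<or> B \<in> T"
    then show "(A \<^bold>\<rightarrow> B) \<in> T"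
    proof
      assume "A \<notin> T"
      show ?thesis
      proof (rule ccontr)
        assume "(A \<^bold>\<rightarrow> B) \<notin> T"
        \<comment> \<open>Neither A nor A -> B is in T, so each of them implies F within T, and the
          case distinction puts F itself into T.\<close>
        with \<open>A \<notin> T\<close> have "(A \<^bold>\<rightarrow> F) \<in> T" "((A \<^bold>\<rightarrow> B) \<^bold>\<rightarrow> F) \<in> T"
          using imp_F by auto
        then show False
          using T derivable_imp_cases theory_over_mp theory_over_theorem by blast
      qed
    next
      assume "B \<in> T"
      then show ?thesis
        using T(1) derivable_K theory_over_mp theory_over_theorem by blast
    qed
  qed
  ultimately show ?thesis
    by (simp add: saturated_def)
qed

lemma ex_saturated_theory:
  assumes "\<not> (CS \<turnstile> F)"
  obtains T where "theory_over CS T" "saturated T" "F \<notin> T"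
proof -
  define \<A> where "\<A> = {T. theory_over CS T \<and> F \<notin> T}"
  \<comment> \<open>The set of all theorems is a member, because F is not derivable.\<close>
  have "\<A> \<noteq> {}"
    using assms theory_over_theorems[of CS] by (auto simp: \<A>_def)
  moreover have "\<Union>\<C> \<in> \<A>" if "\<C> \<noteq> {}" "subset.chain \<A> \<C>" for \<C>
  proof -
    have "subset.chain (Collect (theory_over CS)) \<C>"
      using that(2) by (auto simp: subset.chain_def \<A>_def)
    with that show ?thesis
      using theory_over_Union_chain by (auto simp: subset.chain_def \<A>_def)
  qed
  ultimately obtain T where "T \<in> \<A>" "\<forall>X\<in>\<A>. T \<subseteq> X \<longrightarrow> X = T"
    using subset_Zorn_nonempty[of \<A>] by blast
  then have "theory_over CS T" "F \<notin> T" "saturated T"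
    by (auto simp: \<A>_def intro!: saturated_if_maximal[of CS T F])
  then show thesis
    using that by blast
qed

definition canonical_evaluation :: "'p fm set \<Rightarrow> 'p evaluation" where
  "canonical_evaluation T =
     \<lparr>aval = (\<lambda>P. Atom P \<in> T), pval = (\<lambda>l. {F. (l \<^bold>: F) \<in> T}), jval = (\<lambda>t. {F. (\<^bold>[t\<^bold>] F) \<in> T})\<rparr>"

text \<open>Truth of atoms and of both modal forms is a lookup in the evaluation, so these cases
  hold by construction. Saturation supplies falsum and implication.\<close>

lemma truth_canonical_evaluation:
  assumes "saturated T"
  shows "(canonical_evaluation T \<tturnstile> F) \<longleftrightarrow> F \<in> T"
  using assms by (induction F) (auto simp: canonical_evaluation_def saturated_def)

text \<open>This reverses the soundness argument: all theorems lie in T and so are true, and the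
  truth clauses turn each axiom into the condition matching it. Necessitation gives the condition on
  \<open>CS\<close>.\<close>

lemma basic_model_canonical_evaluation:
  assumes T: "theory_over CS T" and sat: "saturated T"
  shows "basic_model CS (canonical_evaluation T)"
proof -
  let ?\<epsilon> = "canonical_evaluation T"
  have thm_true: "?\<epsilon> \<tturnstile> G" if "CS \<turnstile> G" for G
    using that T sat theory_over_theorem truth_canonical_evaluation by blast
  have ax_true: "?\<epsilon> \<tturnstile> G" if "JE_axiom G" for G
    using that thm_true JE_derivable.ax by blast
  have "basic_evaluation CS ?\<epsilon>"
    unfolding basic_evaluation_def
  proof (intro conjI allI impI)
    fix l k
    show "app_set (pval ?\<epsilon> l) (pval ?\<epsilon> k) \<subseteq> pval ?\<epsilon> (l \<^bold>\<cdot> k)"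
      using ax_true[OF JE_axiom.j] by (auto simp: app_set_def)
    show "pval ?\<epsilon> l \<union> pval ?\<epsilon> k \<subseteq> pval ?\<epsilon> (l \<^bold>+ k)"
      using ax_true[OF JE_axiom.jplus] by auto
    show "jval ?\<epsilon> (E l) \<union> jval ?\<epsilon> (E k) \<subseteq> jval ?\<epsilon> (E (l \<^bold>+ k))"
      using ax_true[OF JE_axiom.jeplus] by auto
  next
    fix l F assume "(l, F) \<in> CS"
    then show "F \<in> pval ?\<epsilon> l"
      using thm_true[OF JE_derivable.an] by simp
  next
    fix l
    show "prf_set l (pval ?\<epsilon> l) \<subseteq> pval ?\<epsilon> (\<^bold>! l)"
      using ax_true[OF JE_axiom.j4] by (auto simp: prf_set_def)
    \<comment> \<open>The axiom is used with F and G exchanged, as it has to lead from the witness G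
      in \<open>odot_set\<close> to F.\<close>
    show "pval ?\<epsilon> l \<odot> jval ?\<epsilon> (E l) \<subseteq> jval ?\<epsilon> (E l)"
      using ax_true[OF JE_axiom.je] by (auto simp: odot_set_def)
  qed
  moreover have "factive ?\<epsilon>"
    using ax_true[OF JE_axiom.jt] by (auto simp: factive_def)
  ultimately show ?thesis
    by (simp add: basic_model_def)
qed

theorem mainTheorem1:
  fixes CS :: "(ptm \<times> 'p::countable fm) set" and F :: "'p fm"
  assumes "constant_specification CS"
  shows "(CS \<turnstile> F) \<longleftrightarrow> (\<forall>\<epsilon>. basic_model CS \<epsilon> \<longrightarrow> (\<epsilon> \<tturnstile> F))"
proof (intro iffI allI impI)
  fix \<epsilon> assume "CS \<turnstile> F" "basic_model CS \<epsilon>"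
  then show "\<epsilon> \<tturnstile> F"
    by (rule soundness)
next
  assume valid: "\<forall>\<epsilon>. basic_model CS \<epsilon> \<longrightarrow> (\<epsilon> \<tturnstile> F)"
  show "CS \<turnstile> F"
  proof (rule ccontr)
    assume "\<not> (CS \<turnstile> F)"
    then obtain T where "theory_over CS T" "saturated T" "F \<notin> T"
      by (rule ex_saturated_theory)
    then show False
      using valid basic_model_canonical_evaluation truth_canonical_evaluation by blast
  qed
qed

end
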